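(* There is an algorithm that, given $n\ge 1$ products with revenues $r_i\ge 0$, preference weights $\nu_i>0$ and leaving probabilities $p_i^0\in[0,1]$ ($i=1,\dots,n$), performs a number of arithmetic operations and comparisons polynomial in $n$ and returns an optimal solution of the unconstrained assortment problem with exactly one top-priority product, $$\max_{S\subseteq\{1,\dots,n\}}\ \pi(S)\sum_{i\in S}\rho_i(S)\,r_i .$$
   Context: For $S\subseteq\{1,\dots,n\}$ put $\bar S=\{1,\dots,n\}\setminus S$ (the unavailable products). The purchase probabilities are multinomial logit: $\rho_i(S)=\nu_i/(1+\sum_{j\in S}\nu_j)$ for $i\in S$ (the no-purchase option has weight $1$). When preference lists contain one top-priority product, the worst-case probability that a customer stays in the store is $\pi(S)=\min_{i\in\bar S}(1-p_i^0)$ if $\bar S\ne\emptyset$, and $\pi(\{1,\dots,n\})=1$. The empty sum equals $0$. *)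

theory Defs
  imports Complex_Main "HOL-Computational_Algebra.Polynomial"
begin

section \<open>The assortment problem\<close>

text \<open>Products are the numbers \<open>1, \<dots>, n\<close>; the arguments \<open>r\<close>, \<open>\<nu>\<close>, \<open>p\<close> only matter on \<open>{1..n}\<close>.\<close>

definition purchase_prob :: "(nat \<Rightarrow> real) \<Rightarrow> nat set \<Rightarrow> nat \<Rightarrow> real" where
  "purchase_prob \<nu> S i = \<nu> i / (1 + (\<Sum>j\<in>S. \<nu> j))"

definition stay_prob :: "nat \<Rightarrow> (nat \<Rightarrow> real) \<Rightarrow> nat set \<Rightarrow> real" where
  "stay_prob n p S =
     (if {1..n} - S = {} then 1 else Min ((\<lambda>i. 1 - p i) ` ({1..n} - S)))"

definition worst_case_revenue ::
  "nat \<Rightarrow> (nat \<Rightarrow> real) \<Rightarrow> (nat \<Rightarrow> real) \<Rightarrow> (nat \<Rightarrow> real) \<Rightarrow> nat set \<Rightarrow> real" where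
  "worst_case_revenue n r \<nu> p S = stay_prob n p S * (\<Sum>i\<in>S. purchase_prob \<nu> S i * r i)"

definition optimal_assortment ::
  "nat \<Rightarrow> (nat \<Rightarrow> real) \<Rightarrow> (nat \<Rightarrow> real) \<Rightarrow> (nat \<Rightarrow> real) \<Rightarrow> nat set \<Rightarrow> bool" where
  "optimal_assortment n r \<nu> p S \<longleftrightarrow>
     is_arg_max (worst_case_revenue n r \<nu> p) (\<lambda>T. T \<subseteq> {1..n}) S"


section \<open>Algorithms: structured programs for a real random access machine\<close>

text \<open>
  A machine state consists of index registers holding natural numbers and of arrays of exact
  real numbers. Real numbers can only be copied, combined by the four arithmetic operations
  and compared; in particular there is no rounding and no conversion between reals and indices.
  Programs are finite syntactic objects that do not depend on the input size. Their only
  literals are integers, so that no information can be hidden in real constants, and index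
  registers can change by at most one per step except by loading a literal or copying, so
  that their contents stay bounded by the input size plus the running time plus a constant.
\<close>

record state =
  ireg :: "nat \<Rightarrow> nat"
  rmem :: "nat \<Rightarrow> nat \<Rightarrow> real"

text \<open>\<open>Cell a x\<close> addresses the entry of array \<open>a\<close> at the index currently held in register \<open>x\<close>.\<close>

datatype cell = Cell nat nat

fun val :: "state \<Rightarrow> cell \<Rightarrow> real" where
  "val s (Cell a x) = rmem s a (ireg s x)"

fun store :: "cell \<Rightarrow> real \<Rightarrow> state \<Rightarrow> state" where
  "store (Cell a x) v s = s\<lparr>rmem := (rmem s)(a := (rmem s a)(ireg s x := v))\<rparr>"

definition set_ireg :: "nat \<Rightarrow> nat \<Rightarrow> state \<Rightarrow> state" where
  "set_ireg x k s = s\<lparr>ireg := (ireg s)(x := k)\<rparr>"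

datatype instr =
    ISet nat nat
  | ICopy nat nat
  | IInc nat
  | IDec nat
  | RSet cell int
  | RCopy cell cell
  | RAdd cell cell cell
  | RSub cell cell cell
  | RMul cell cell cell
  | RDiv cell cell cell

text \<open>The first argument of an instruction is its target. Division by zero has no result.\<close>

fun step :: "instr \<Rightarrow> state \<Rightarrow> state option" where
  "step (ISet x k) s = Some (set_ireg x k s)"
| "step (ICopy x y) s = Some (set_ireg x (ireg s y) s)"
| "step (IInc x) s = Some (set_ireg x (ireg s x + 1) s)"
| "step (IDec x) s = Some (set_ireg x (ireg s x - 1) s)"
| "step (RSet c k) s = Some (store c (of_int k) s)"
| "step (RCopy c d) s = Some (store c (val s d) s)"
| "step (RAdd c d e) s = Some (store c (val s d + val s e) s)"
| "step (RSub c d e) s = Some (store c (val s d - val s e) s)"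
| "step (RMul c d e) s = Some (store c (val s d * val s e) s)"
| "step (RDiv c d e) s = (if val s e = 0 then None else Some (store c (val s d / val s e) s))"

datatype test =
    ILess nat nat
  | ILeq nat nat
  | RLess cell cell
  | RLeq cell cell

fun holds :: "test \<Rightarrow> state \<Rightarrow> bool" where
  "holds (ILess x y) s \<longleftrightarrow> ireg s x < ireg s y"
| "holds (ILeq x y) s \<longleftrightarrow> ireg s x \<le> ireg s y"
| "holds (RLess c d) s \<longleftrightarrow> val s c < val s d"
| "holds (RLeq c d) s \<longleftrightarrow> val s c \<le> val s d"

datatype prog =
    Skip
  | Instr instr
  | Seq prog prog
  | Cond test prog prog
  | While test prog

text \<open>
  \<open>exec P s t s'\<close>: started in \<open>s\<close>, program \<open>P\<close> terminates in \<open>s'\<close>, and \<open>t\<close> is the number of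
  executed instructions plus the number of evaluated tests. Thus \<open>t\<close> bounds the number of
  arithmetic operations and comparisons, on reals as well as on indices; loads and copies are
  counted too, which matters only up to a constant factor depending on the program.
\<close>

inductive exec :: "prog \<Rightarrow> state \<Rightarrow> nat \<Rightarrow> state \<Rightarrow> bool" where
  Skip: "exec Skip s 0 s"
| Instr: "step i s = Some s' \<Longrightarrow> exec (Instr i) s 1 s'"
| Seq: "exec P s t s' \<Longrightarrow> exec Q s' u s'' \<Longrightarrow> exec (Seq P Q) s (t + u) s''"
| CondTrue: "holds b s \<Longrightarrow> exec P s t s' \<Longrightarrow> exec (Cond b P Q) s (1 + t) s'"
| CondFalse: "\<not> holds b s \<Longrightarrow> exec Q s t s' \<Longrightarrow> exec (Cond b P Q) s (1 + t) s'"
| WhileFalse: "\<not> holds b s \<Longrightarrow> exec (While b P) s 1 s"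
| WhileTrue: "holds b s \<Longrightarrow> exec P s t s' \<Longrightarrow> exec (While b P) s' u s'' \<Longrightarrow>
    exec (While b P) s (1 + t + u) s''"

inductive_cases exec_SkipE: "exec Skip s t s'"
inductive_cases exec_InstrE: "exec (Instr i) s t s'"
inductive_cases exec_SeqE: "exec (Seq P Q) s t s'"
inductive_cases exec_CondE: "exec (Cond b P Q) s t s'"
inductive_cases exec_WhileE: "exec (While b P) s t s'"

lemma exec_deterministic:
  "exec P s t s' \<Longrightarrow> exec P s u s'' \<Longrightarrow> u = t \<and> s'' = s'"
proof (induction arbitrary: u s'' rule: exec.induct)
  case (Skip s)
  from Skip.prems show ?case by (rule exec_SkipE) simp
next
  case (Instr i s s')
  from Instr.prems show ?case by (rule exec_InstrE) (simp add: Instr.hyps)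
next
  case (Seq P s t s' Q v w)
  from Seq.prems show ?case
  proof (rule exec_SeqE)
    fix t1 s1 u1
    assume a: "u = t1 + u1" "exec P s t1 s1" "exec Q s1 u1 s''"
    from Seq.IH(1)[OF a(2)] have e: "t1 = t" "s1 = s'" by simp_all
    from Seq.IH(2)[OF a(3)[unfolded e]] show ?thesis by (simp add: a(1) e)
  qed
next
  case (CondTrue b s P t s' Q)
  from CondTrue.prems show ?case
    by (rule exec_CondE) (simp_all add: CondTrue.hyps(1) CondTrue.IH)
next
  case (CondFalse b s Q t s' P)
  from CondFalse.prems show ?case
    by (rule exec_CondE) (simp_all add: CondFalse.hyps(1) CondFalse.IH)
next
  case (WhileFalse b s P)
  from WhileFalse.prems show ?case
    by (rule exec_WhileE) (simp_all add: WhileFalse.hyps)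
next
  case (WhileTrue b s P t s' v w)
  from WhileTrue.prems show ?case
  proof (rule exec_WhileE)
    assume "\<not> holds b s"
    with WhileTrue.hyps(1) show ?thesis by simp
  next
    fix t1 s1 u1
    assume a: "u = Suc (t1 + u1)" "exec P s t1 s1" "exec (While b P) s1 u1 s''"
    from WhileTrue.IH(1)[OF a(2)] have e: "t1 = t" "s1 = s'" by simp_all
    from WhileTrue.IH(2)[OF a(3)[unfolded e]] show ?thesis by (simp add: a(1) e)
  qed
qed

text \<open>
  Input convention: register 0 holds \<open>n\<close>; arrays 0, 1, 2 hold \<open>r\<close>, \<open>\<nu>\<close>, \<open>p\<close> at the
  indices \<open>1, \<dots>, n\<close>; everything else is 0. Output convention: array 3 holds at the indices
  \<open>1, \<dots>, n\<close> the indicator vector of the returned set.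
\<close>

definition input_state ::
  "nat \<Rightarrow> (nat \<Rightarrow> real) \<Rightarrow> (nat \<Rightarrow> real) \<Rightarrow> (nat \<Rightarrow> real) \<Rightarrow> state" where
  "input_state n r \<nu> p =
     \<lparr>ireg = (\<lambda>_. 0)(0 := n),
      rmem = (\<lambda>a i. if i \<in> {1..n}
                    then (if a = 0 then r i else if a = 1 then \<nu> i else if a = 2 then p i else 0)
                    else 0)\<rparr>"

definition returns :: "nat \<Rightarrow> state \<Rightarrow> nat set \<Rightarrow> bool" where
  "returns n s S \<longleftrightarrow> S \<subseteq> {1..n} \<and> (\<forall>i\<in>{1..n}. rmem s 3 i = of_bool (i \<in> S))"

end

theory Submission
  imports Defs
begin

text \<open>
  The optimum is found by enumerating \<open>(n + 1)\<^sup>2\<close> assortments. The stay probability of an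
  assortment \<open>S\<close> that omits some product is \<open>1 - p j\<close> for some unavailable product \<open>j\<close>, and then \<open>S\<close> contains every
  product \<open>i\<close> with \<open>p i > p j\<close>. Conversely, any assortment containing all these products has a stay
  probability of at least \<open>1 - p j\<close>, so for a fixed \<open>j\<close> it remains to make the logit revenue
  large. If \<open>z\<close> is the logit revenue of \<open>S\<close>, then adding products with revenue at least \<open>z\<close> and
  removing products with revenue at most \<open>z\<close> does not lower it (\<open>mnl_revenue_exchange\<close>).
  Hence \<open>S\<close> may be replaced by \<open>{i. p i > p j \<or> r i > z}\<close>, and the threshold \<open>z\<close> may be lowered
  to the largest \<open>r k \<le> z\<close> without changing this set.

  Both thresholds range over the products and a sentinel at index 0 with \<open>p 0 = r 0 = 0\<close>. The
  sentinel stands for an assortment without unavailable products, respectively for a \<open>z\<close> below all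
  revenues. The program does not compute stay probabilities: it maximises \<open>score j k\<close>, which uses
  \<open>1 - p j\<close> in their place. By \<open>score_le_worst_case_revenue\<close> the score is a lower bound for the
  true value of its candidate, and by \<open>worst_case_revenue_le_score\<close> every assortment is matched by
  some score, so a candidate with the largest score is optimal (\<open>optimal_candidate\<close>).

  The program consists of three nested loops followed by one loop that writes the indicator vector.
  Loop-free code is verified, together with its running time, by symbolic execution (\<open>runs_wp\<close>);
  counting loops are verified by an invariant (\<open>runs_For\<close>), and each of them multiplies the running
  time by a linear factor.
\<close>

section \<open>Quadratically many candidate assortments\<close>

definition mnl_revenue :: "(nat \<Rightarrow> real) \<Rightarrow> (nat \<Rightarrow> real) \<Rightarrow> nat set \<Rightarrow> real" where
  "mnl_revenue r \<nu> S = (\<Sum>i\<in>S. r i * \<nu> i) / (1 + (\<Sum>i\<in>S. \<nu> i))"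

lemma worst_case_revenue_eq:
  "worst_case_revenue n r \<nu> p S = stay_prob n p S * mnl_revenue r \<nu> S"
  by (simp add: worst_case_revenue_def purchase_prob_def mnl_revenue_def
      sum_divide_distrib mult.commute)

text \<open>
  The logit revenue of \<open>T\<close> is at least \<open>z\<close> iff \<open>(\<Sum>i\<in>T. (r i - z) * \<nu> i) \<ge> z\<close>. For \<open>z\<close> the
  revenue of \<open>S\<close> this is an equality at \<open>T = S\<close>, and the exchange changes the sum only by
  adding nonnegative terms and removing nonpositive ones.
\<close>

lemma mnl_revenue_exchange:
  assumes fin: "finite S" "finite S'"
    and pos: "\<And>i. i \<in> S \<union> S' \<Longrightarrow> 0 \<le> \<nu> i"
    and add: "\<And>i. i \<in> S' - S \<Longrightarrow> mnl_revenue r \<nu> S \<le> r i"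
    and remove: "\<And>i. i \<in> S - S' \<Longrightarrow> r i \<le> mnl_revenue r \<nu> S"
  shows "mnl_revenue r \<nu> S \<le> mnl_revenue r \<nu> S'"
proof -
  define z where "z = mnl_revenue r \<nu> S"
  define g where "g i = (r i - z) * \<nu> i" for i
  have den: "0 < 1 + (\<Sum>i\<in>S. \<nu> i)" "0 < 1 + (\<Sum>i\<in>S'. \<nu> i)"
    using pos by (auto intro!: add_pos_nonneg sum_nonneg)
  have split: "sum g T = (\<Sum>i\<in>T. r i * \<nu> i) - z * (\<Sum>i\<in>T. \<nu> i)" for T
    by (simp add: g_def left_diff_distrib sum_subtractf sum_distrib_left)
  have "z * (1 + (\<Sum>i\<in>S. \<nu> i)) = (\<Sum>i\<in>S. r i * \<nu> i)"
    using den by (simp add: z_def mnl_revenue_def)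
  hence "z = sum g S" by (simp add: split algebra_simps)
  also have "\<dots> = sum g (S \<inter> S') + sum g (S - S')"
    using fin by (simp add: sum.Int_Diff)
  also have "\<dots> \<le> sum g (S \<inter> S') + sum g (S' - S)"
  proof -
    have "sum g (S - S') \<le> 0"
      using pos remove by (intro sum_nonpos) (auto simp: g_def z_def mult_le_0_iff)
    moreover have "0 \<le> sum g (S' - S)"
      using pos add by (intro sum_nonneg) (auto simp: g_def z_def)
    ultimately show ?thesis by simp
  qed
  also have "\<dots> = sum g S'"
    using fin sum.Int_Diff[of S' g S] by (simp add: Int_commute)
  finally have "z * (1 + (\<Sum>i\<in>S'. \<nu> i)) \<le> (\<Sum>i\<in>S'. r i * \<nu> i)"
    by (simp add: split algebra_simps)
  thus ?thesis
    using den by (simp add: mnl_revenue_def[of _ _ S'] z_def pos_le_divide_eq)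
qed

locale assortment_instance =
  fixes n :: nat and r \<nu> p :: "nat \<Rightarrow> real"
  assumes nonneg: "\<And>i. i \<in> {1..n} \<Longrightarrow> 0 \<le> r i \<and> 0 < \<nu> i \<and> 0 \<le> p i \<and> p i \<le> 1"
begin

text \<open>
  Index 0 is no product, and the input convention fills it with 0, which makes it the sentinel for
  both thresholds.
\<close>

definition padded :: "(nat \<Rightarrow> real) \<Rightarrow> nat \<Rightarrow> real" where
  "padded f i = (if i \<in> {1..n} then f i else 0)"

definition selected :: "nat \<Rightarrow> nat \<Rightarrow> nat \<Rightarrow> bool" where
  "selected j k i \<longleftrightarrow> padded p j < padded p i \<or> padded r k < padded r i"

definition candidate :: "nat \<Rightarrow> nat \<Rightarrow> nat set" where
  "candidate j k = {i \<in> {1..n}. selected j k i}"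

definition score :: "nat \<Rightarrow> nat \<Rightarrow> real" where
  "score j k = (1 - padded p j) * mnl_revenue r \<nu> (candidate j k)"

lemma candidate_subset: "candidate j k \<subseteq> {1..n}"
  by (auto simp: candidate_def)

lemma padded_nonneg: "0 \<le> padded r i" "0 \<le> padded p i" "padded p i \<le> 1"
  using nonneg by (auto simp: padded_def)

lemma mnl_revenue_nonneg: "S \<subseteq> {1..n} \<Longrightarrow> 0 \<le> mnl_revenue r \<nu> S"
proof -
  assume S: "S \<subseteq> {1..n}"
  have "0 \<le> r i" "0 \<le> \<nu> i" if "i \<in> S" for i
    using S that nonneg[of i] by force+
  thus ?thesis
    unfolding mnl_revenue_def
    by (intro divide_nonneg_nonneg add_nonneg_nonneg sum_nonneg mult_nonneg_nonneg) auto
qed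

lemma score_nonneg: "0 \<le> score j k"
  using padded_nonneg(3)[of j] mnl_revenue_nonneg[OF candidate_subset]
  by (simp add: score_def)

text \<open>
  A product outside \<open>candidate j k\<close> has a leaving probability of at most that of \<open>j\<close>; if there is
  no such product, the stay probability is 1, and the bound is trivial.
\<close>

lemma score_le_worst_case_revenue:
  "score j k \<le> worst_case_revenue n r \<nu> p (candidate j k)"
proof -
  have "1 - padded p j \<le> stay_prob n p (candidate j k)"
    using padded_nonneg(2)[of j]
    by (auto simp: stay_prob_def candidate_def selected_def padded_def not_less)
  thus ?thesis
    using mnl_revenue_nonneg[OF candidate_subset]
    by (simp add: score_def worst_case_revenue_eq mult_right_mono)
qed

text \<open>
  The index \<open>j\<close> is an unavailable product attaining the minimum, or the sentinel if every product
  is available.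
\<close>

lemma stay_prob_attained:
  assumes "S \<subseteq> {1..n}"
  obtains j where "j \<le> n" "stay_prob n p S = 1 - padded p j"
    "\<And>i. i \<in> {1..n} - S \<Longrightarrow> p i \<le> padded p j"
proof (cases "{1..n} - S = {}")
  case True
  thus ?thesis by (intro that[of 0]) (auto simp: stay_prob_def padded_def)
next
  case False
  let ?M = "(\<lambda>i. 1 - p i) ` ({1..n} - S)"
  have M: "stay_prob n p S = Min ?M" using False unfolding stay_prob_def by (rule if_not_P)
  have "Min ?M \<in> ?M" using False by (intro Min_in) auto
  then obtain j where j: "j \<in> {1..n} - S" "Min ?M = 1 - p j" by auto
  have "1 - p j \<le> 1 - p i" if "i \<in> {1..n} - S" for i
    using that unfolding j(2)[symmetric] by (intro Min_le) auto
  with j M show ?thesis by (intro that[of j]) (auto simp: padded_def)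
qed

text \<open>
  The pair \<open>(j, k)\<close> makes the candidate exactly \<open>{i. p i > padded p j \<or> r i > z}\<close> with \<open>z\<close> the
  logit revenue of \<open>S\<close>: there is no padded revenue strictly between \<open>padded r k\<close> and \<open>z\<close>.
\<close>

lemma worst_case_revenue_le_score:
  assumes S: "S \<subseteq> {1..n}"
  obtains j k where "j \<le> n" "k \<le> n" "worst_case_revenue n r \<nu> p S \<le> score j k"
proof -
  define z where "z = mnl_revenue r \<nu> S"
  have z: "0 \<le> z" using S by (simp add: z_def mnl_revenue_nonneg)
  obtain j where j: "j \<le> n" "stay_prob n p S = 1 - padded p j"
      "\<And>i. i \<in> {1..n} - S \<Longrightarrow> p i \<le> padded p j"
    using stay_prob_attained[OF S] by blast
  \<comment> \<open>The sentinel makes \<open>?K\<close> nonempty even if all revenues exceed \<open>z\<close>.\<close>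
  let ?K = "{k \<in> {0..n}. padded r k \<le> z}"
  have "0 \<in> ?K" using z by (simp add: padded_def)
  hence "Max (padded r ` ?K) \<in> padded r ` ?K" by (intro Max_in) auto
  then obtain k where k: "k \<in> ?K" "Max (padded r ` ?K) = padded r k" by blast
  have k_max: "padded r i \<le> padded r k" if "i \<in> ?K" for i
    using that by (auto simp flip: k(2))
  have "mnl_revenue r \<nu> S \<le> mnl_revenue r \<nu> (candidate j k)"
  proof (rule mnl_revenue_exchange)
    show "finite S" "finite (candidate j k)"
      using S finite_subset candidate_subset by blast+
    show "0 \<le> \<nu> i" if "i \<in> S \<union> candidate j k" for i
      using that S candidate_subset[of j k] nonneg[of i] by fastforce
    show "mnl_revenue r \<nu> S \<le> r i" if "i \<in> candidate j k - S" for i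
      using that j(3)[of i] k_max[of i]
      by (fastforce simp: candidate_def selected_def padded_def z_def[symmetric])
    show "r i \<le> mnl_revenue r \<nu> S" if "i \<in> S - candidate j k" for i
      using that S k(1)
      by (fastforce simp: candidate_def selected_def padded_def z_def[symmetric])
  qed
  hence "worst_case_revenue n r \<nu> p S \<le> score j k"
    using padded_nonneg(3)[of j]
    by (simp add: worst_case_revenue_eq score_def j(2) mult_left_mono)
  with j(1) k(1) show ?thesis by (intro that[of j k]) auto
qed

lemma optimal_candidate:
  assumes "\<And>j' k'. j' \<le> n \<Longrightarrow> k' \<le> n \<Longrightarrow> score j' k' \<le> score j k"
  shows "optimal_assortment n r \<nu> p (candidate j k)"
proof -
  have "worst_case_revenue n r \<nu> p T \<le> worst_case_revenue n r \<nu> p (candidate j k)"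
    if "T \<subseteq> {1..n}" for T
  proof -
    obtain j' k' where "j' \<le> n" "k' \<le> n" "worst_case_revenue n r \<nu> p T \<le> score j' k'"
      using worst_case_revenue_le_score[OF \<open>T \<subseteq> {1..n}\<close>] by blast
    with assms[of j' k'] score_le_worst_case_revenue[of j k] show ?thesis by linarith
  qed
  thus ?thesis
    using candidate_subset by (auto simp: optimal_assortment_def is_arg_max_def not_less)
qed

end

section \<open>Timed weakest preconditions\<close>

definition runs :: "prog \<Rightarrow> state \<Rightarrow> nat \<Rightarrow> (state \<Rightarrow> bool) \<Rightarrow> bool" where
  "runs P s T Q \<longleftrightarrow> (\<exists>t s'. exec P s t s' \<and> t \<le> T \<and> Q s')"

text \<open>
  Only meaningful for loop-free programs, as is \<open>wp\<close>: the weakest precondition of a loop is set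
  to \<open>False\<close>, so that the value chosen for its cost never enters a bound.
\<close>

fun cost :: "prog \<Rightarrow> nat" where
  "cost Skip = 0"
| "cost (Instr i) = 1"
| "cost (Seq P Q) = cost P + cost Q"
| "cost (Cond b P Q) = 1 + max (cost P) (cost Q)"
| "cost (While b P) = 0"

fun wp :: "prog \<Rightarrow> (state \<Rightarrow> bool) \<Rightarrow> state \<Rightarrow> bool" where
  "wp Skip Q s = Q s"
| "wp (Instr i) Q s = (case step i s of None \<Rightarrow> False | Some s' \<Rightarrow> Q s')"
| "wp (Seq P P') Q s = wp P (wp P' Q) s"
| "wp (Cond b P P') Q s = (if holds b s then wp P Q s else wp P' Q s)"
| "wp (While b P) Q s = False"

lemma runs_Seq:
  assumes "runs P s T M" and "\<And>s'. M s' \<Longrightarrow> runs Q s' U R"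
  shows "runs (Seq P Q) s (T + U) R"
  using assms unfolding runs_def by (meson exec.Seq add_mono)

lemma runs_mono:
  assumes "runs P s T Q" "T \<le> T'" "\<And>s'. Q s' \<Longrightarrow> Q' s'"
  shows "runs P s T' Q'"
  using assms unfolding runs_def by (meson order_trans)

lemma runs_wp: "wp P Q s \<Longrightarrow> runs P s (cost P) Q"
proof (induction P arbitrary: Q s)
  case Skip
  thus ?case by (auto simp: runs_def intro!: exI exec.Skip)
next
  case (Instr i)
  thus ?case by (auto simp: runs_def split: option.splits intro!: exI exec.Instr)
next
  case (Seq P P')
  have "runs P s (cost P) (wp P' Q)" using Seq by simp
  from runs_Seq[OF this Seq.IH(2)] show ?case by simp
next
  case (Cond b P P')
  show ?case
  proof (cases "holds b s")
    case True
    with Cond have "runs P s (cost P) Q" by simp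
    then obtain t s' where "exec P s t s'" "t \<le> cost P" "Q s'" by (auto simp: runs_def)
    with exec.CondTrue[OF True, of P t s' P'] show ?thesis
      unfolding runs_def by (intro exI[of _ "1 + t"] exI[of _ s']) auto
  next
    case False
    with Cond have "runs P' s (cost P') Q" by simp
    then obtain t s' where "exec P' s t s'" "t \<le> cost P'" "Q s'" by (auto simp: runs_def)
    with exec.CondFalse[OF False, of P' t s' P] show ?thesis
      unfolding runs_def by (intro exI[of _ "1 + t"] exI[of _ s']) auto
  qed
qed simp

text \<open>
  By the input convention, register 0 holds the number of products; every loop of the program
  ends there.
\<close>

definition For :: "nat \<Rightarrow> nat \<Rightarrow> prog \<Rightarrow> prog" where
  "For x a P =
     Seq (Instr (ISet x a)) (While (ILeq x 0) (Seq P (Instr (IInc x))))"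

definition advance :: "nat \<Rightarrow> state \<Rightarrow> state" where
  "advance x s = set_ireg x (Suc (ireg s x)) s"

lemma runs_While:
  assumes body: "\<And>i s. I i s \<Longrightarrow> i \<le> n \<Longrightarrow> runs P s T (\<lambda>s'. I (Suc i) (advance x s'))"
    and counter: "\<And>i s. I i s \<Longrightarrow> ireg s x = i \<and> ireg s 0 = n"
    and "I i s" "i \<le> Suc n"
  shows "runs (While (ILeq x 0) (Seq P (Instr (IInc x)))) s
           ((Suc n - i) * (T + 2) + 1) (I (Suc n))"
  using assms(3,4)
proof (induction "Suc n - i" arbitrary: i s)
  case 0
  hence "i = Suc n" by simp
  with 0 counter[OF 0(2)] show ?case
    unfolding runs_def by (intro exI[of _ 1] exI[of _ s] conjI exec.WhileFalse) auto
next
  case (Suc d)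
  hence i: "i \<le> n" and d: "d = Suc n - Suc i" by simp_all
  let ?W = "While (ILeq x 0) (Seq P (Instr (IInc x)))"
  obtain t s' where t: "exec P s t s'" "t \<le> T" "I (Suc i) (advance x s')"
    using body[OF Suc.prems(1) i] by (auto simp: runs_def)
  obtain u s'' where u: "exec ?W (advance x s') u s''" "u \<le> d * (T + 2) + 1" "I (Suc n) s''"
    using Suc.hyps(1)[OF d t(3)] i d by (auto simp: runs_def)
  have "exec (Instr (IInc x)) s' 1 (advance x s')"
    by (rule exec.Instr) (simp add: advance_def)
  hence "exec ?W s (1 + (t + 1) + u) s''"
    using counter[OF Suc.prems(1)] i by (intro exec.WhileTrue[OF _ exec.Seq[OF t(1)] u(1)]) auto
  moreover have "1 + (t + 1) + u \<le> (Suc n - i) * (T + 2) + 1"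
    using t(2) u(2) unfolding Suc.hyps(2)[symmetric] by simp
  ultimately show ?case using u(3) unfolding runs_def by blast
qed

text \<open>
  Each of the at most \<open>n + 1\<close> iterations adds a test and an increment to the body; the initial
  assignment and the last test come on top.
\<close>

definition loop_time :: "nat \<Rightarrow> nat \<Rightarrow> nat" where
  "loop_time n T = (n + 1) * (T + 2) + 2"

lemma runs_For:
  assumes "\<And>i s. I i s \<Longrightarrow> i \<le> n \<Longrightarrow> runs P s T (\<lambda>s'. I (Suc i) (advance x s'))"
    and "\<And>i s. I i s \<Longrightarrow> ireg s x = i \<and> ireg s 0 = n"
    and "I a (set_ireg x a s)" "a \<le> Suc n"
  shows "runs (For x a P) s (loop_time n T) (I (Suc n))"
proof -
  have "runs (While (ILeq x 0) (Seq P (Instr (IInc x)))) (set_ireg x a s)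
          ((Suc n - a) * (T + 2) + 1) (I (Suc n))"
    using assms by (rule runs_While)
  hence "runs (For x a P) s (cost (Instr (ISet x a)) + ((Suc n - a) * (T + 2) + 1)) (I (Suc n))"
    unfolding For_def by (intro runs_Seq[OF runs_wp, where M = "\<lambda>s'. s' = set_ireg x a s"]) auto
  moreover have "(Suc n - a) * (T + 2) \<le> (n + 1) * (T + 2)" by (intro mult_right_mono) auto
  ultimately show ?thesis by (elim runs_mono) (auto simp: loop_time_def)
qed

section \<open>The program\<close>

text \<open>
  Register 3 runs over the products. Registers 1 and 2 hold the thresholds of the current candidate
  and registers 4 and 5 those of the best one so far. Register 6 stays 0, so that the cells
  addressed through it serve as plain real variables.
\<close>

abbreviation "r_at x \<equiv> Cell 0 x"
abbreviation "weight_at x \<equiv> Cell 1 x"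
abbreviation "leave_at x \<equiv> Cell 2 x"
abbreviation "out_at x \<equiv> Cell 3 x"
abbreviation "numer \<equiv> Cell 4 6"
abbreviation "denom \<equiv> Cell 5 6"
abbreviation "temp \<equiv> Cell 6 6"
abbreviation "best \<equiv> Cell 7 6"

definition if_selected :: "nat \<Rightarrow> nat \<Rightarrow> prog \<Rightarrow> prog" where
  "if_selected x y P =
     Cond (RLess (leave_at x) (leave_at 3)) P (Cond (RLess (r_at y) (r_at 3)) P Skip)"

definition add_product :: prog where
  "add_product =
     Seq (Instr (RMul temp (r_at 3) (weight_at 3)))
    (Seq (Instr (RAdd numer numer temp))
         (Instr (RAdd denom denom (weight_at 3))))"

definition clear_sums :: prog where
  "clear_sums = Seq (Instr (RSet numer 0)) (Instr (RSet denom 1))"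

definition update_best :: prog where
  "update_best =
     Seq (Instr (RDiv numer numer denom))
    (Seq (Instr (RSet temp 1))
    (Seq (Instr (RSub temp temp (leave_at 1)))
    (Seq (Instr (RMul numer temp numer))
         (Cond (RLess best numer)
           (Seq (Instr (RCopy best numer)) (Seq (Instr (ICopy 4 1)) (Instr (ICopy 5 2))))
           Skip))))"

definition evaluate :: prog where
  "evaluate = Seq clear_sums (Seq (For 3 1 (if_selected 1 2 add_product)) update_best)"

definition search :: prog where
  "search = For 1 0 (For 2 0 evaluate)"

definition write_best :: prog where
  "write_best = For 3 1 (if_selected 4 5 (Instr (RSet (out_at 3) 1)))"

context assortment_instance
begin

definition layout :: "(nat \<Rightarrow> real) \<Rightarrow> nat \<Rightarrow> nat \<Rightarrow> state \<Rightarrow> bool" where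
  "layout w j k s \<longleftrightarrow> ireg s 0 = n \<and> ireg s 6 = 0 \<and> ireg s 1 = j \<and> ireg s 2 = k \<and>
     rmem s 0 = padded r \<and> rmem s 1 = padded \<nu> \<and> rmem s 2 = padded p \<and> rmem s 3 = w"

text \<open>
  The recorded value need only be a lower bound for the score of the recorded candidate. This makes
  the invariant true initially, for the value 0 and the pair \<open>(0, 0)\<close>, since scores are
  nonnegative.
\<close>

definition best_among :: "(nat \<times> nat) set \<Rightarrow> state \<Rightarrow> bool" where
  "best_among X s \<longleftrightarrow>
     (\<forall>(j, k)\<in>X. score j k \<le> rmem s 7 0) \<and> rmem s 7 0 \<le> score (ireg s 4) (ireg s 5)"

definition picked :: "nat \<Rightarrow> nat \<Rightarrow> nat \<Rightarrow> nat set" where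
  "picked j k i = {l \<in> {1..<i}. selected j k l}"

definition partial_sums :: "nat \<Rightarrow> nat \<Rightarrow> nat \<Rightarrow> state \<Rightarrow> bool" where
  "partial_sums j k i s \<longleftrightarrow> ireg s 3 = i \<and>
     rmem s 4 0 = (\<Sum>l\<in>picked j k i. r l * \<nu> l) \<and>
     rmem s 5 0 = 1 + (\<Sum>l\<in>picked j k i. \<nu> l)"

lemma picked_Suc:
  "1 \<le> i \<Longrightarrow> picked j k (Suc i) =
    (if selected j k i then insert i (picked j k i) else picked j k i)"
  by (auto simp: picked_def less_Suc_eq)

lemma picked_all: "picked j k (Suc n) = candidate j k"
  by (auto simp: picked_def candidate_def)

lemma sum_picked_Suc:
  assumes "1 \<le> i"
  shows "sum f (picked j k (Suc i)) =
    (if selected j k i then sum f (picked j k i) + f i else sum f (picked j k i))"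
proof -
  have "finite (picked j k i)" "i \<notin> picked j k i"
    by (simp_all add: picked_def)
  thus ?thesis using assms by (simp add: picked_Suc add.commute)
qed

lemmas exec_simps = set_ireg_def advance_def if_selected_def add_product_def clear_sums_def
  update_best_def layout_def best_among_def partial_sums_def

lemma runs_sums:
  assumes "layout w j k s" "best_among X s" "rmem s 4 0 = 0" "rmem s 5 0 = 1"
  shows "runs (For 3 1 (if_selected 1 2 add_product)) s
           (loop_time n (cost (if_selected 1 2 add_product)))
           (\<lambda>s. layout w j k s \<and> best_among X s \<and> partial_sums j k (Suc n) s)"
proof -
  let ?I = "\<lambda>i s. 1 \<le> i \<and> layout w j k s \<and> best_among X s \<and> partial_sums j k i s"
  have "runs (For 3 1 (if_selected 1 2 add_product)) s
          (loop_time n (cost (if_selected 1 2 add_product))) (?I (Suc n))"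
  proof (rule runs_For)
    fix i s assume I: "?I i s" and i: "i \<le> n"
    from I i have pad: "padded r i = r i" "padded \<nu> i = \<nu> i" by (auto simp: padded_def)
    show "runs (if_selected 1 2 add_product) s (cost (if_selected 1 2 add_product))
            (\<lambda>s'. ?I (Suc i) (advance 3 s'))"
    proof (rule runs_wp)
      show "wp (if_selected 1 2 add_product) (\<lambda>s'. ?I (Suc i) (advance 3 s')) s"
        using I pad by (simp add: exec_simps sum_picked_Suc) (simp add: selected_def)
    qed
  qed (use assms in \<open>auto simp: exec_simps picked_def\<close>)
  thus ?thesis by (rule runs_mono) auto
qed

lemma final_sums:
  assumes "partial_sums j k (Suc n) s"
  shows "rmem s 4 0 / rmem s 5 0 = mnl_revenue r \<nu> (candidate j k)" "rmem s 5 0 \<noteq> 0"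
proof -
  from assms have sums: "rmem s 4 0 = (\<Sum>l\<in>candidate j k. r l * \<nu> l)"
      "rmem s 5 0 = 1 + (\<Sum>l\<in>candidate j k. \<nu> l)"
    by (simp_all add: partial_sums_def picked_all)
  thus "rmem s 4 0 / rmem s 5 0 = mnl_revenue r \<nu> (candidate j k)"
    by (simp add: mnl_revenue_def)
  have "0 \<le> (\<Sum>l\<in>candidate j k. \<nu> l)"
    using nonneg candidate_subset by (intro sum_nonneg less_imp_le) blast
  with sums show "rmem s 5 0 \<noteq> 0" by simp
qed

lemma runs_update_best:
  assumes "layout w j k s" "best_among X s" "partial_sums j k (Suc n) s"
  shows "runs update_best s (cost update_best)
           (\<lambda>s. layout w j k s \<and> best_among (insert (j, k) X) s)"
proof (rule runs_wp)
  show "wp update_best (\<lambda>s. layout w j k s \<and> best_among (insert (j, k) X) s) s"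
    using assms(1,2) final_sums[OF assms(3)]
    by (auto simp: update_best_def layout_def best_among_def score_def set_ireg_def)
qed

definition evaluate_time :: nat where
  "evaluate_time = cost clear_sums +
     (loop_time n (cost (if_selected 1 2 add_product)) + cost update_best)"

lemma runs_evaluate:
  assumes "layout w j k s" "best_among X s"
  shows "runs evaluate s evaluate_time (\<lambda>s. layout w j k s \<and> best_among (insert (j, k) X) s)"
  unfolding evaluate_def evaluate_time_def
proof (rule runs_Seq)
  let ?M = "\<lambda>s. layout w j k s \<and> best_among X s \<and> rmem s 4 0 = 0 \<and> rmem s 5 0 = 1"
  have "wp clear_sums ?M s"
    using assms by (simp add: exec_simps)
  thus "runs clear_sums s (cost clear_sums) ?M" by (rule runs_wp)
  fix s assume "?M s"
  thus "runs (Seq (For 3 1 (if_selected 1 2 add_product)) update_best) s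
      (loop_time n (cost (if_selected 1 2 add_product)) + cost update_best)
      (\<lambda>s. layout w j k s \<and> best_among (insert (j, k) X) s)"
    by (intro runs_Seq[OF runs_sums] runs_update_best) auto
qed

lemma runs_search:
  assumes "layout w j k s" "best_among {} s"
  shows "runs search s (loop_time n (loop_time n evaluate_time))
           (\<lambda>s. \<exists>j k. layout w j k s \<and> best_among ({..n} \<times> {..n}) s)"
proof -
  let ?I = "\<lambda>j s. \<exists>k. layout w j k s \<and> best_among ({..<j} \<times> {..n}) s"
  have "runs search s (loop_time n (loop_time n evaluate_time)) (?I (Suc n))"
    unfolding search_def
  proof (rule runs_For)
    fix j s assume "?I j s" and "j \<le> n"
    then obtain k where s: "layout w j k s" "best_among ({..<j} \<times> {..n}) s" by blast
    let ?J = "\<lambda>k s. layout w j k s \<and> best_among ({..<j} \<times> {..n} \<union> {j} \<times> {..<k}) s"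
    have "runs (For 2 0 evaluate) s (loop_time n evaluate_time) (?J (Suc n))"
    proof (rule runs_For)
      fix k s assume J: "?J k s" and "k \<le> n"
      have ins: "{..<j} \<times> {..n} \<union> {j} \<times> {..<Suc k} =
          insert (j, k) ({..<j} \<times> {..n} \<union> {j} \<times> {..<k})" by (auto simp: less_Suc_eq)
      show "runs evaluate s evaluate_time (\<lambda>s'. ?J (Suc k) (advance 2 s'))"
        unfolding ins using J
        by (intro runs_mono[OF runs_evaluate])
          (auto simp: layout_def best_among_def advance_def set_ireg_def)
    qed (use s in \<open>auto simp: layout_def best_among_def set_ireg_def\<close>)
    moreover have "{..<j} \<times> {..n} \<union> {j} \<times> {..<Suc n} = {..<Suc j} \<times> {..n}" by auto
    ultimately have "runs (For 2 0 evaluate) s (loop_time n evaluate_time)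
        (\<lambda>s. layout w j (Suc n) s \<and> best_among ({..<Suc j} \<times> {..n}) s)"
      by simp
    thus "runs (For 2 0 evaluate) s (loop_time n evaluate_time) (\<lambda>s'. ?I (Suc j) (advance 1 s'))"
      by (rule runs_mono) (auto simp: layout_def best_among_def advance_def set_ireg_def)
  qed (use assms in \<open>auto simp: layout_def best_among_def set_ireg_def\<close>)
  thus ?thesis by (rule runs_mono) (auto simp: lessThan_Suc_atMost)
qed

lemma runs_write_best:
  assumes "layout (\<lambda>_. 0) j k s" and sel: "ireg s 4 = j'" "ireg s 5 = k'"
  shows "runs write_best s (loop_time n (cost (if_selected 4 5 (Instr (RSet (out_at 3) 1)))))
           (\<lambda>s. returns n s (candidate j' k'))"
proof -
  let ?P = "if_selected 4 5 (Instr (RSet (out_at 3) 1))"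
  let ?w = "\<lambda>i l. of_bool (l \<in> picked j' k' i)"
  let ?I = "\<lambda>i s. 1 \<le> i \<and> layout (?w i) j k s \<and> ireg s 3 = i \<and> ireg s 4 = j' \<and> ireg s 5 = k'"
  have "runs write_best s (loop_time n (cost ?P)) (?I (Suc n))"
    unfolding write_best_def
  proof (rule runs_For)
    fix i s assume I: "?I i s" and "i \<le> n"
    have w: "?w (Suc i) = (if selected j' k' i then (?w i)(i := 1) else ?w i)"
      using I by (auto simp: picked_Suc fun_eq_iff)
    show "runs ?P s (cost ?P) (\<lambda>s'. ?I (Suc i) (advance 3 s'))"
    proof (rule runs_wp)
      show "wp ?P (\<lambda>s'. ?I (Suc i) (advance 3 s')) s"
        using I unfolding w by (simp add: exec_simps) (simp add: selected_def)
    qed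
  qed (use assms in \<open>auto simp: layout_def set_ireg_def picked_def\<close>)
  thus ?thesis
    using candidate_subset[of j' k']
    by (elim runs_mono) (simp_all add: layout_def returns_def picked_all)
qed

definition total_time :: nat where
  "total_time = loop_time n (loop_time n evaluate_time) +
     loop_time n (cost (if_selected 4 5 (Instr (RSet (out_at 3) 1))))"

lemma runs_program:
  "runs (Seq search write_best) (input_state n r \<nu> p) total_time
     (\<lambda>s. \<exists>S. returns n s S \<and> optimal_assortment n r \<nu> p S)"
  unfolding total_time_def
proof (rule runs_Seq)
  have "layout (\<lambda>_. 0) 0 0 (input_state n r \<nu> p)" "best_among {} (input_state n r \<nu> p)"
    using score_nonneg
    by (simp_all add: layout_def best_among_def input_state_def padded_def fun_eq_iff)
  thus "runs search (input_state n r \<nu> p) (loop_time n (loop_time n evaluate_time))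
     (\<lambda>s. \<exists>j k. layout (\<lambda>_. 0) j k s \<and> best_among ({..n} \<times> {..n}) s)"
    by (rule runs_search)
next
  fix s assume "\<exists>j k. layout (\<lambda>_. 0) j k s \<and> best_among ({..n} \<times> {..n}) s"
  then obtain j k where s: "layout (\<lambda>_. 0) j k s" "best_among ({..n} \<times> {..n}) s" by blast
  have "optimal_assortment n r \<nu> p (candidate (ireg s 4) (ireg s 5))"
  proof (rule optimal_candidate)
    fix j' k' assume "j' \<le> n" "k' \<le> n"
    with s(2) have "score j' k' \<le> rmem s 7 0" by (auto simp: best_among_def)
    also have "\<dots> \<le> score (ireg s 4) (ireg s 5)" using s(2) by (simp add: best_among_def)
    finally show "score j' k' \<le> score (ireg s 4) (ireg s 5)" .
  qed
  thus "runs write_best s (loop_time n (cost (if_selected 4 5 (Instr (RSet (out_at 3) 1)))))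
     (\<lambda>s. \<exists>S. returns n s S \<and> optimal_assortment n r \<nu> p S)"
    by (intro runs_mono[OF runs_write_best[OF s(1) refl refl]]) auto
qed

end

text \<open>
  The running time is a polynomial in \<open>n\<close> because \<open>loop_time\<close> is one in \<open>n\<close> and the running time
  of the loop body.
\<close>

definition loop_poly :: "nat poly \<Rightarrow> nat poly" where
  "loop_poly q = [:1, 1:] * (q + 2) + 2"

lemma poly_loop_poly: "poly (loop_poly q) n = loop_time n (poly q n)"
  by (simp add: loop_poly_def loop_time_def algebra_simps)

definition time_poly :: "nat poly" where
  "time_poly = loop_poly (loop_poly ([:cost clear_sums:] +
      (loop_poly [:cost (if_selected 1 2 add_product):] + [:cost update_best:]))) +
    loop_poly [:cost (if_selected 4 5 (Instr (RSet (out_at 3) 1))):]"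

lemma (in assortment_instance) poly_time_poly: "poly time_poly n = total_time"
  by (simp add: time_poly_def total_time_def evaluate_time_def poly_loop_poly)

theorem mainTheorem1:
  "\<exists>(P :: prog) (q :: nat poly).
     \<forall>(n :: nat) (r :: nat \<Rightarrow> real) (\<nu> :: nat \<Rightarrow> real) (p :: nat \<Rightarrow> real).
       n \<ge> 1 \<longrightarrow>
       (\<forall>i\<in>{1..n}. r i \<ge> 0 \<and> \<nu> i > 0 \<and> 0 \<le> p i \<and> p i \<le> 1) \<longrightarrow>
       (\<exists>t s S. exec P (input_state n r \<nu> p) t s \<and> t \<le> poly q n \<and>
                returns n s S \<and> optimal_assortment n r \<nu> p S)"
proof (rule exI[of _ "Seq search write_best"], rule exI[of _ time_poly], intro allI impI)
  fix n :: nat and r \<nu> p :: "nat \<Rightarrow> real"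
  assume "\<forall>i\<in>{1..n}. r i \<ge> 0 \<and> \<nu> i > 0 \<and> 0 \<le> p i \<and> p i \<le> 1"
  then interpret assortment_instance n r \<nu> p by unfold_locales blast
  show "\<exists>t s S. exec (Seq search write_best) (input_state n r \<nu> p) t s \<and> t \<le> poly time_poly n \<and>
      returns n s S \<and> optimal_assortment n r \<nu> p S"
    using runs_program unfolding runs_def poly_time_poly by blast
qed

end
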